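(* Let $\lambda\in(-\tfrac12,0)\cup(0,\infty)$ and let $n>1$ be an integer. Then $$\big\|\mathcal{C}_{n-2}^{(\lambda+1)}\big\|_2^2=\frac{n^2-2\lambda n}{2^4\lambda^3}\big[\mathcal{C}_{n}^{(\lambda)}(1)\big]^2+\frac{n(2n+1)}{2^3\lambda^2}\big\|\mathcal{C}_{n}^{(\lambda)}\big\|_2^2-\sum_{k=0}^{n-1}\frac{\lambda+k}{2^2\lambda^2}\big\|\mathcal{C}_{k}^{(\lambda)}\big\|_2^2 .$$
   Context: For $\lambda\in(-\tfrac12,0)\cup(0,\infty)$ and $n\in\mathbb{N}_0=\{0,1,2,\dots\}$, the Gegenbauer polynomial $\mathcal{C}_n^{(\lambda)}$ of index $\lambda$ and degree $n$ is the coefficient of $\alpha^n$ in the power series expansion $(1-2x\alpha+\alpha^2)^{-\lambda}=\sum_{n=0}^\infty \mathcal{C}_n^{(\lambda)}(x)\alpha^n$. For continuous $f:[0,1]\to\mathbb{R}$, $\|f\|_2^2:=\int_0^1[f(x)]^2\,\mathrm{d}x$ (note that the integral is over $[0,1]$, with unweighted Lebesgue measure). *)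

theory Defs
  imports "HOL-Complex_Analysis.Complex_Analysis"
begin

text \<open>
  The coefficient of \<open>\<alpha>^n\<close> in the power series expansion of \<open>(1 - 2x\<alpha> + \<alpha>\<^sup>2) powr (-\<lambda>)\<close> about
  \<open>\<alpha> = 0\<close>. The description is well-defined for all real \<open>\<lambda>\<close> and \<open>x\<close>: existence of the
  expansion is \<open>gegenbauer_expansion_exists\<close>, uniqueness is \<open>has_fps_expansion_unique_real\<close>.
\<close>
definition gegenbauer :: "real \<Rightarrow> nat \<Rightarrow> real \<Rightarrow> real" where
  "gegenbauer l n x =
     fps_nth (THE F. (\<lambda>a. (1 - 2 * x * a + a\<^sup>2) powr (-l)) has_fps_expansion F) n"

text \<open>\<open>\<parallel>f\<parallel>\<^sub>2\<^sup>2\<close>; the interval is \<open>[0,1]\<close>, and there is no Gegenbauer weight.\<close>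
definition l2_norm_sq :: "(real \<Rightarrow> real) \<Rightarrow> real" where
  "l2_norm_sq f = integral {0..1} (\<lambda>x. (f x)\<^sup>2)"

lemma has_fps_expansion_unique_real:
  fixes F G :: "real fps"
  assumes F: "f has_fps_expansion F" and G: "f has_fps_expansion G"
  shows "F = G"
proof (rule ccontr)
  assume "F \<noteq> G"
  define H where "H = F - G"
  have "H \<noteq> 0" using \<open>F \<noteq> G\<close> by (simp add: H_def)
  have H: "(\<lambda>x. 0) has_fps_expansion H"
    using has_fps_expansion_diff[OF F G] by (simp add: H_def)
  then have rad: "fps_conv_radius H > 0" and ev: "eventually (\<lambda>z. eval_fps H z = 0) (nhds 0)"
    by (auto simp: has_fps_expansion_def)
  have 0: "eval_fps H 0 = 0" using ev by (rule eventually_nhds_x_imp_x)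
  then have "fps_nth H 0 = 0" by (simp add: eval_fps_at_0)
  with \<open>H \<noteq> 0\<close> obtain m where m: "fps_nth H m \<noteq> 0" "m > 0"
    by (metis fps_ext fps_zero_nth gr0I)
  obtain r where r: "0 < r" "ereal r < fps_conv_radius H"
    using ereal_dense2[OF rad] by auto
  have "(\<lambda>n. fps_nth H n * (x - 0) ^ n) sums eval_fps H x" if "norm (x - 0) < r" for x
  proof -
    have "ereal (norm x) < fps_conv_radius H"
      using that r(2) by (metis diff_zero ereal_less_eq(3) le_less_trans less_imp_le)
    from sums_eval_fps[OF this] show ?thesis by (simp only: diff_zero)
  qed
  from powser_0_nonzero[OF r(1) this 0 m]
  obtain s where s: "0 < s" "\<And>z. z \<in> cball 0 s - {0} \<Longrightarrow> eval_fps H z \<noteq> 0"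
    by auto
  from ev obtain d where d: "d > 0" "\<And>z. dist z 0 < d \<Longrightarrow> eval_fps H z = 0"
    by (auto simp: eventually_nhds_metric)
  define z where "z = min s (d / 2)"
  have z: "0 < z" "z \<le> s" "z < d" using s(1) d(1) by (auto simp: z_def)
  then have "eval_fps H z \<noteq> 0" "eval_fps H z = 0"
    by (auto intro!: s(2) d(2))
  then show False by simp
qed

lemma gegenbauer_expansion_exists:
  fixes l x :: real
  shows "(\<lambda>a. (1 - 2 * x * a + a\<^sup>2) powr (-l)) has_fps_expansion
           (fps_binomial (-l) oo (fps_X ^ 2 - fps_const (2 * x) * fps_X))"
    (is "?f has_fps_expansion ?R")
proof -
  let ?G = "fps_X ^ 2 - fps_const (2 * complex_of_real x) * fps_X"
  let ?C = "fps_binomial (- complex_of_real l) oo ?G"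
  have "((\<lambda>a. (1 + a) powr (- complex_of_real l)) \<circ> (\<lambda>a. a ^ 2 - (2 * complex_of_real x) * a))
          has_fps_expansion ?C"
    by (intro has_fps_expansion_compose has_fps_expansion_binomial_complex fps_expansion_intros)
       auto
  then have C: "fps_conv_radius ?C > 0"
    and evC: "eventually (\<lambda>a. eval_fps ?C a =
                (1 + (a ^ 2 - (2 * complex_of_real x) * a)) powr (- complex_of_real l)) (nhds 0)"
    by (auto simp: has_fps_expansion_def)
  let ?H = "fps_X ^ 2 - fps_const (2 * x) * fps_X :: real fps"
  have gb: "(- complex_of_real l) gchoose i = of_real ((-l) gchoose i)" for i
    by (simp add: gbinomial_prod_rev)
  have pw: "fps_nth (?G ^ i) n = of_real (fps_nth (?H ^ i) n)" for i n
  proof (induction i arbitrary: n)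
    case 0 then show ?case by simp
  next
    case (Suc i)
    have "fps_nth ?G m = of_real (fps_nth ?H m)" for m
      by (simp add: fps_X_power_nth)
    then show ?case using Suc by (simp add: fps_mult_nth)
  qed
  have nth: "fps_nth ?C n = of_real (fps_nth ?R n)" for n
    by (simp add: fps_compose_nth gb pw)
  have rad: "fps_conv_radius ?R = fps_conv_radius ?C"
    unfolding fps_conv_radius_def by (rule conv_radius_cong) (simp add: nth)
  have ev_ball: "eventually (\<lambda>a::real. a \<in> eball 0 (fps_conv_radius ?R)) (nhds 0)"
    using C rad by (intro eventually_nhds_in_open) (auto simp: zero_ereal_def)
  have evR: "eventually (\<lambda>a::real. eval_fps ?C (of_real a) =
                (1 + ((of_real a) ^ 2 - (2 * complex_of_real x) * of_real a))
                   powr (- complex_of_real l)) (nhds 0)"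
  proof -
    have "filterlim complex_of_real (nhds 0) (nhds 0)"
      using tendsto_of_real[OF filterlim_ident, of "0::real", where ?'a = complex] by simp
    from eventually_compose_filterlim[OF evC this] show ?thesis .
  qed
  have ev_pos: "eventually (\<lambda>a::real. 1 - 2 * x * a + a\<^sup>2 > 0) (nhds 0)"
  proof -
    have "((\<lambda>a::real. 1 - 2 * x * a + a\<^sup>2) \<longlongrightarrow> 1 - 2 * x * 0 + 0\<^sup>2) (nhds 0)"
      by (intro tendsto_intros filterlim_ident)
    then show ?thesis by (rule order_tendstoD) simp
  qed
  have "eventually (\<lambda>a. eval_fps ?R a = ?f a) (nhds 0)"
    using ev_ball evR ev_pos
  proof eventually_elim
    case (elim a)
    have "(\<lambda>n. fps_nth ?R n * a ^ n) sums eval_fps ?R a"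
      using elim(1) by (intro sums_eval_fps) auto
    then have "(\<lambda>n. complex_of_real (fps_nth ?R n * a ^ n)) sums of_real (eval_fps ?R a)"
      by (rule sums_of_real)
    then have "complex_of_real (eval_fps ?R a) = eval_fps ?C (of_real a)"
      by (simp add: eval_fps_def nth sums_iff)
    also have "\<dots> = (complex_of_real (1 - 2 * x * a + a\<^sup>2)) powr (complex_of_real (-l))"
      using elim(2) by (simp add: algebra_simps)
    also have "\<dots> = of_real (?f a)"
      using elim(3) by (intro powr_of_real) auto
    finally show ?case using of_real_eq_iff by blast
  qed
  then show ?thesis using C rad by (simp add: has_fps_expansion_def)
qed

lemma gegenbauer_eq_fps_nth:
  "gegenbauer l n x =
     fps_nth (fps_binomial (-l) oo (fps_X ^ 2 - fps_const (2 * x) * fps_X)) n"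
proof -
  have "(THE F. (\<lambda>a. (1 - 2 * x * a + a\<^sup>2) powr (-l)) has_fps_expansion F) =
          fps_binomial (-l) oo (fps_X ^ 2 - fps_const (2 * x) * fps_X)" (is "The ?P = ?R")
  proof (rule the_equality)
    show "?P ?R" by (rule gegenbauer_expansion_exists)
    show "F = ?R" if "?P F" for F
      by (rule has_fps_expansion_unique_real[OF that \<open>?P ?R\<close>])
  qed
  then show ?thesis by (simp only: gegenbauer_def)
qed

end

(*
  Write C_n for the Gegenbauer polynomials of index l and C_n' for their derivatives in x. The
  generating function gives C_n' = 2 l C_{n-1}^(l+1) together with
    x C_{n+1}' - C_n' = (n+1) C_{n+1}   and   C_{n+1}' - x C_n' = (n+2l) C_n.
  Multiplying these by C_{n+1}, C_n, C_n', C_{n+1}' and integrating by parts over [0,1] (the product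
  C_n C_{n+1} is odd, so it contributes no boundary term at 0) yields a first-order recurrence for
  the squared norms of C_n and a formula for the difference of the squared norms of C_{n+1}' and
  C_n'. The claim, multiplied by 4 l^2, then follows by induction on n.
*)
theory Submission
  imports Defs
begin

section \<open>Differentiating power series coefficientwise in a parameter\<close>

text \<open>A coefficient of a Cauchy product is a finite sum, so Leibniz' rule applies term by term
  and convergence plays no part.\<close>

lemma fps_nth_mult_has_real_derivative:
  fixes A B :: "real \<Rightarrow> real fps"
  assumes "\<And>n. ((\<lambda>x. fps_nth (A x) n) has_real_derivative fps_nth A' n) (at x)"
    and "\<And>n. ((\<lambda>x. fps_nth (B x) n) has_real_derivative fps_nth B' n) (at x)"
  shows "((\<lambda>x. fps_nth (A x * B x) n) has_real_derivative fps_nth (A' * B x + A x * B') n) (at x)"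
  unfolding fps_mult_nth fps_add_nth sum.distrib[symmetric]
  by (intro DERIV_sum) (auto intro!: derivative_eq_intros assms)

lemma fps_nth_power_has_real_derivative:
  fixes A :: "real \<Rightarrow> real fps"
  assumes "\<And>n. ((\<lambda>x. fps_nth (A x) n) has_real_derivative fps_nth A' n) (at x)"
  shows "((\<lambda>x. fps_nth (A x ^ i) n) has_real_derivative
           fps_nth (of_nat i * A x ^ (i - 1) * A') n) (at x)"
proof (induction i arbitrary: n)
  case 0
  then show ?case by simp
next
  case (Suc i)
  have "A' * A x ^ i + A x * (of_nat i * A x ^ (i - 1) * A') =
          of_nat (Suc i) * A x ^ (Suc i - 1) * A'"
    by (cases i) (simp_all add: algebra_simps)
  then show ?case
    using fps_nth_mult_has_real_derivative[OF assms Suc.IH, of n] by simp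
qed

text \<open>Coefficientwise this is the absorption identity (n+1) binom(c, n+1) = c binom(c-1,
  n).\<close>

lemma fps_deriv_binomial_shift:
  fixes c :: "'a::field_char_0"
  shows "fps_deriv (fps_binomial c) = fps_const c * fps_binomial (c - 1)"
proof (rule fps_ext)
  fix n
  show "fps_nth (fps_deriv (fps_binomial c)) n = fps_nth (fps_const c * fps_binomial (c - 1)) n"
    using gbinomial_absorption[of n c] by (simp add: mult.commute)
qed

section \<open>The generating function as a formal power series\<close>

text \<open>With T for this series, the generating function is (1 + T)^(-l). The constant term of T
  is 0, so composing with T is a genuine substitution.\<close>

definition gegenbauer_arg :: "real \<Rightarrow> real fps" where
  "gegenbauer_arg x = fps_X ^ 2 - fps_const (2 * x) * fps_X"

definition gegenbauer_fps :: "real \<Rightarrow> real \<Rightarrow> real fps" where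
  "gegenbauer_fps l x = fps_binomial (-l) oo gegenbauer_arg x"

lemma gegenbauer_arg_nth_0 [simp]: "fps_nth (gegenbauer_arg x) 0 = 0"
  by (simp add: gegenbauer_arg_def)

lemma gegenbauer_eq: "gegenbauer l n x = fps_nth (gegenbauer_fps l x) n"
  by (simp add: gegenbauer_eq_fps_nth gegenbauer_fps_def gegenbauer_arg_def)

lemma gegenbauer_fps_nth_0 [simp]: "fps_nth (gegenbauer_fps l x) 0 = 1"
  by (simp add: gegenbauer_fps_def)

lemma gegenbauer_0 [simp]: "gegenbauer l 0 = (\<lambda>_. 1)"
  by (simp add: fun_eq_iff gegenbauer_eq)

text \<open>The exponent law (1 + T)^(-l) = (1 + T)^(-(l+1)) (1 + T), with T =
  \<open>gegenbauer_arg x\<close>.\<close>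

lemma gegenbauer_fps_plus_1:
  "gegenbauer_fps l x = gegenbauer_fps (l + 1) x * (1 + gegenbauer_arg x)"
proof -
  have "fps_binomial (-l) = fps_binomial (-(l + 1)) * (1 + fps_X :: real fps)"
    using fps_binomial_add_mult[of "-(l + 1)" 1] by (simp add: fps_binomial_1)
  then show ?thesis
    by (simp add: gegenbauer_fps_def fps_compose_mult_distrib fps_compose_add_distrib)
qed

text \<open>Chain rule in the series variable: the inner derivative is 2 (X - x), and the outer one
  raises the index to l+1.\<close>

lemma fps_deriv_gegenbauer_fps:
  "fps_deriv (gegenbauer_fps l x) =
     fps_const (2 * l) * gegenbauer_fps (l + 1) x * (fps_const x - fps_X)"
proof -
  have "fps_deriv (gegenbauer_arg x) = 2 * (fps_X - fps_const x)"
    by (rule fps_ext) (auto simp: gegenbauer_arg_def fps_X_power_nth numeral_fps_const)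
  then have "fps_deriv (gegenbauer_fps l x) =
      - fps_const l * gegenbauer_fps (l + 1) x * (2 * (fps_X - fps_const x))"
    by (simp add: gegenbauer_fps_def fps_compose_deriv fps_deriv_binomial_shift
        fps_compose_mult_distrib)
  also have "\<dots> = 2 * fps_const l * gegenbauer_fps (l + 1) x * (fps_const x - fps_X)"
    by (simp add: algebra_simps del: fps_const_neg)
  also have "2 * fps_const l = fps_const (2 * l)"
    by (simp add: numeral_fps_const)
  finally show ?thesis .
qed

section \<open>Derivatives in x and the two identities they satisfy\<close>

text \<open>This is C_n'. Differentiating (1 - 2xa + a^2)^(-l) in x gives a factor 2 l a, which
  shifts the degree by one. Degree 0 is separate because \<open>n - 1\<close> truncates
  there.\<close>

definition gegenbauer_deriv :: "real \<Rightarrow> nat \<Rightarrow> real \<Rightarrow> real" where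
  "gegenbauer_deriv l n x = (if n = 0 then 0 else 2 * l * gegenbauer (l + 1) (n - 1) x)"

lemma gegenbauer_deriv_eq:
  "gegenbauer_deriv l n x = fps_nth (fps_const (2 * l) * gegenbauer_fps (l + 1) x * fps_X) n"
  by (simp add: gegenbauer_deriv_def gegenbauer_eq)

text \<open>Each coefficient of the composition is a finite sum of coefficients of powers of
  \<open>gegenbauer_arg x\<close>, so the chain rule in x can be carried out termwise.\<close>

lemma gegenbauer_has_real_derivative:
  "(gegenbauer l n has_real_derivative gegenbauer_deriv l n x) (at x within S)"
proof -
  define b where "b = fps_binomial (-l)"
  \<comment> \<open>The coefficientwise x-derivative of \<open>gegenbauer_arg x\<close>, constant in
    x.\<close>
  define A' where "A' = fps_const (-2) * (fps_X :: real fps)"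
  have A': "((\<lambda>x. fps_nth (gegenbauer_arg x) m) has_real_derivative fps_nth A' m) (at x)" for m
    unfolding gegenbauer_arg_def A'_def by (auto intro!: derivative_eq_intros simp: fps_X_def)
  have "((\<lambda>x. gegenbauer l n x) has_real_derivative
      (\<Sum>i=0..n. fps_nth b i * fps_nth (of_nat i * gegenbauer_arg x ^ (i - 1) * A') n)) (at x)"
    unfolding gegenbauer_eq gegenbauer_fps_def fps_compose_nth b_def[symmetric]
    by (intro DERIV_sum DERIV_cmult fps_nth_power_has_real_derivative A')
  also have "(\<Sum>i=0..n. fps_nth b i * fps_nth (of_nat i * gegenbauer_arg x ^ (i - 1) * A') n) =
      fps_nth ((fps_deriv b oo gegenbauer_arg x) * A') n"
  proof (cases n)
    case 0
    then show ?thesis by (simp add: A'_def)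
  next
    case (Suc m)
    have *: "fps_nth (B * A') n = - 2 * fps_nth B m" for B
      by (simp add: A'_def Suc mult.left_commute[of B])
    have "(\<Sum>i=0..n. fps_nth b i * fps_nth (of_nat i * gegenbauer_arg x ^ (i - 1) * A') n) =
        (\<Sum>i=0..Suc m. fps_nth b i * (- 2 * (of_nat i * fps_nth (gegenbauer_arg x ^ (i - 1)) m)))"
      unfolding * by (simp add: Suc fps_of_nat[symmetric])
    \<comment> \<open>The term i = 0 vanishes through its factor i; after the shift, the factors
      \<open>Suc i\<close> and \<open>fps_nth b (Suc i)\<close> form a coefficient of
      \<open>fps_deriv b\<close>.\<close>
    also have "\<dots> = (\<Sum>i=0..m. fps_nth b (Suc i) *
        (- 2 * (of_nat (Suc i) * fps_nth (gegenbauer_arg x ^ i) m)))"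
      by (subst sum.atLeast0_atMost_Suc_shift) simp
    also have "\<dots> = fps_nth ((fps_deriv b oo gegenbauer_arg x) * A') n"
      unfolding * by (simp add: fps_compose_nth sum_distrib_left algebra_simps)
    finally show ?thesis .
  qed
  also have "(fps_deriv b oo gegenbauer_arg x) = fps_const (-l) * gegenbauer_fps (l + 1) x"
    by (simp add: b_def fps_deriv_binomial_shift gegenbauer_fps_def fps_compose_mult_distrib)
  also have "fps_nth (fps_const (-l) * gegenbauer_fps (l + 1) x * A') n = gegenbauer_deriv l n x"
  proof -
    have "fps_const (-l) * gegenbauer_fps (l + 1) x * A' =
        (fps_const (-l) * fps_const (-2)) * gegenbauer_fps (l + 1) x * fps_X"
      unfolding A'_def by (simp only: ac_simps)
    also have "fps_const (-l) * fps_const (-2) = fps_const (2 * l)" by (simp add: mult.commute)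
    finally show ?thesis by (simp only: gegenbauer_deriv_eq)
  qed
  finally show ?thesis by (rule has_field_derivative_at_within)
qed

text \<open>Both sides are the coefficient of X^n in F' = 2 l E (x - X), where F and E are the
  generating functions of index l and l+1.\<close>

lemma gegenbauer_deriv_lower:
  "x * gegenbauer_deriv l (Suc n) x - gegenbauer_deriv l n x = real (Suc n) * gegenbauer l (Suc n) x"
proof -
  have "real (Suc n) * gegenbauer l (Suc n) x = fps_nth (fps_deriv (gegenbauer_fps l x)) n"
    by (simp add: gegenbauer_eq)
  also have "\<dots> = x * gegenbauer_deriv l (Suc n) x - gegenbauer_deriv l n x"
    unfolding fps_deriv_gegenbauer_fps
    by (simp add: gegenbauer_deriv_eq right_diff_distrib)
  finally show ?thesis by simp
qed

text \<open>Compare coefficients of X^n in X F' + 2 l F = 2 l E (1 - x X), where F and E have index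
  l and l+1; the X^2 terms cancel.\<close>

lemma gegenbauer_deriv_upper:
  "gegenbauer_deriv l (Suc n) x - x * gegenbauer_deriv l n x = (real n + 2 * l) * gegenbauer l n x"
proof -
  let ?F = "gegenbauer_fps l x" and ?E = "gegenbauer_fps (l + 1) x"
  have X2: "fps_const (2 * x) = 2 * fps_const x" by (simp add: numeral_fps_const)
  have "fps_X * fps_deriv ?F + fps_const (2 * l) * ?F =
      fps_const (2 * l) * ?E - fps_const x * (fps_const (2 * l) * ?E * fps_X)"
    unfolding fps_deriv_gegenbauer_fps
    unfolding gegenbauer_fps_plus_1[of l x] gegenbauer_arg_def X2
    by (simp add: algebra_simps power2_eq_square)
  from arg_cong[OF this, of "\<lambda>f. fps_nth f n"] show ?thesis
    by (cases n) (auto simp: gegenbauer_deriv_eq gegenbauer_eq algebra_simps)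
qed

section \<open>Values at the end points 1 and 0\<close>

text \<open>At x = 1 the two derivative identities have the same left side.\<close>

lemma gegenbauer_at_1_Suc:
  "real (Suc n) * gegenbauer l (Suc n) 1 = (real n + 2 * l) * gegenbauer l n 1"
  using gegenbauer_deriv_lower[of 1 l n] gegenbauer_deriv_upper[of l n 1] by simp

text \<open>Replaces a parity argument: at x = 0 the two identities eliminate C_{n+1}' and express
  C_{n+2}(0) through C_n(0), so a vanishing product propagates.\<close>

lemma gegenbauer_consecutive_at_0: "gegenbauer l (Suc n) 0 * gegenbauer l n 0 = 0"
proof (induction n)
  case 0
  then show ?case
    using gegenbauer_deriv_lower[of 0 l 0] by (simp add: gegenbauer_deriv_def)
next
  case (Suc n)
  have "real (Suc (Suc n)) * gegenbauer l (Suc (Suc n)) 0 = - (real n + 2 * l) * gegenbauer l n 0"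
    using gegenbauer_deriv_lower[of 0 l "Suc n"] gegenbauer_deriv_upper[of l n 0]
    by (simp add: algebra_simps)
  then have "real (Suc (Suc n)) * (gegenbauer l (Suc (Suc n)) 0 * gegenbauer l (Suc n) 0) =
      - (real n + 2 * l) * (gegenbauer l (Suc n) 0 * gegenbauer l n 0)"
    by (simp only: mult.assoc[symmetric]) (simp add: mult.assoc mult.commute)
  then show ?case using Suc.IH by simp
qed

section \<open>Integrals over [0,1]\<close>

lemma continuous_on_gegenbauer [continuous_intros]: "continuous_on S (gegenbauer l n)"
  by (rule DERIV_continuous_on) (rule gegenbauer_has_real_derivative)

lemma continuous_on_gegenbauer_deriv [continuous_intros]: "continuous_on S (gegenbauer_deriv l n)"
proof (cases n)
  case 0
  then have "gegenbauer_deriv l n = (\<lambda>_. 0)"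
    by (simp add: gegenbauer_deriv_def fun_eq_iff)
  then show ?thesis by simp
next
  case (Suc m)
  then have "gegenbauer_deriv l n = (\<lambda>x. 2 * l * gegenbauer (l + 1) m x)"
    by (simp add: gegenbauer_deriv_def fun_eq_iff)
  then show ?thesis by (simp only:) (intro continuous_intros)
qed

lemma gegenbauer_integral_by_parts:
  "integral {0..1} (\<lambda>x. gegenbauer_deriv l (Suc n) x * gegenbauer l n x) +
   integral {0..1} (\<lambda>x. gegenbauer l (Suc n) x * gegenbauer_deriv l n x) =
   gegenbauer l (Suc n) 1 * gegenbauer l n 1"
proof -
  have "((\<lambda>x. gegenbauer_deriv l (Suc n) x * gegenbauer l n x +
           gegenbauer l (Suc n) x * gegenbauer_deriv l n x) has_integral
         gegenbauer l (Suc n) 1 * gegenbauer l n 1 - gegenbauer l (Suc n) 0 * gegenbauer l n 0)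
         {0..1}"
    by (intro fundamental_theorem_of_calculus)
      (auto intro!: derivative_eq_intros gegenbauer_has_real_derivative
        simp flip: has_real_derivative_iff_has_vector_derivative)
  then show ?thesis
    by (subst integral_add[symmetric])
      (auto intro!: integrable_continuous_real continuous_intros
        simp: gegenbauer_consecutive_at_0 integral_unique)
qed

lemma gegenbauer_integral_x_deriv:
  "2 * integral {0..1} (\<lambda>x. x * gegenbauer_deriv l n x * gegenbauer l n x) =
   (gegenbauer l n 1)\<^sup>2 - l2_norm_sq (gegenbauer l n)"
proof -
  \<comment> \<open>The factors 1 and 0 in the end values exhibit the antiderivative
    \<open>x * (gegenbauer l n x)\<^sup>2\<close>; its factor x removes the boundary term at
    0.\<close>
  have "((\<lambda>x. (gegenbauer l n x)\<^sup>2 + 2 * (x * gegenbauer_deriv l n x * gegenbauer l n x))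
         has_integral 1 * (gegenbauer l n 1)\<^sup>2 - 0 * (gegenbauer l n 0)\<^sup>2) {0..1}"
    by (intro fundamental_theorem_of_calculus)
      (auto intro!: derivative_eq_intros gegenbauer_has_real_derivative
        simp flip: has_real_derivative_iff_has_vector_derivative)
  then have "integral {0..1} (\<lambda>x. (gegenbauer l n x)\<^sup>2 +
      2 * (x * gegenbauer_deriv l n x * gegenbauer l n x)) = (gegenbauer l n 1)\<^sup>2"
    by (simp add: integral_unique)
  then show ?thesis
    unfolding l2_norm_sq_def
    by (subst (asm) integral_add) (auto intro!: integrable_continuous_real continuous_intros)
qed

text \<open>Substituting C_n' from \<open>gegenbauer_deriv_lower\<close> leaves only degree n+1;
  2n+3 arises as 2(n+1) + 1.\<close>

lemma gegenbauer_integral_mult_deriv: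
  "2 * integral {0..1} (\<lambda>x. gegenbauer l (Suc n) x * gegenbauer_deriv l n x) =
   (gegenbauer l (Suc n) 1)\<^sup>2 - (2 * real n + 3) * l2_norm_sq (gegenbauer l (Suc n))"
proof -
  have "integral {0..1} (\<lambda>x. gegenbauer l (Suc n) x * gegenbauer_deriv l n x) =
      integral {0..1} (\<lambda>x. x * gegenbauer_deriv l (Suc n) x * gegenbauer l (Suc n) x
        - real (Suc n) * (gegenbauer l (Suc n) x)\<^sup>2)"
  proof (rule integral_cong)
    fix x
    have d: "gegenbauer_deriv l n x =
        x * gegenbauer_deriv l (Suc n) x - real (Suc n) * gegenbauer l (Suc n) x"
      using gegenbauer_deriv_lower[of x l n] by simp
    show "gegenbauer l (Suc n) x * gegenbauer_deriv l n x =
        x * gegenbauer_deriv l (Suc n) x * gegenbauer l (Suc n) x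
          - real (Suc n) * (gegenbauer l (Suc n) x)\<^sup>2"
      unfolding d by (simp add: algebra_simps power2_eq_square)
  qed
  also have "\<dots> = integral {0..1} (\<lambda>x. x * gegenbauer_deriv l (Suc n) x * gegenbauer l (Suc n) x)
      - real (Suc n) * l2_norm_sq (gegenbauer l (Suc n))"
    unfolding l2_norm_sq_def
    by (subst integral_diff) (auto intro!: integrable_continuous_real continuous_intros)
  finally show ?thesis
    using gegenbauer_integral_x_deriv[of l "Suc n"] by (simp add: algebra_simps)
qed

text \<open>Here \<open>gegenbauer_deriv_upper\<close> removes C_{n+1}' and leaves only degree n;
  2n+4l-1 arises as 2(n+2l) - 1.\<close>

lemma gegenbauer_integral_deriv_mult:
  "2 * integral {0..1} (\<lambda>x. gegenbauer_deriv l (Suc n) x * gegenbauer l n x) =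
   (gegenbauer l n 1)\<^sup>2 + (2 * real n + 4 * l - 1) * l2_norm_sq (gegenbauer l n)"
proof -
  have "integral {0..1} (\<lambda>x. gegenbauer_deriv l (Suc n) x * gegenbauer l n x) =
      integral {0..1} (\<lambda>x. x * gegenbauer_deriv l n x * gegenbauer l n x
        + (real n + 2 * l) * (gegenbauer l n x)\<^sup>2)"
  proof (rule integral_cong)
    fix x
    have d: "gegenbauer_deriv l (Suc n) x =
        x * gegenbauer_deriv l n x + (real n + 2 * l) * gegenbauer l n x"
      using gegenbauer_deriv_upper[of l n x] by simp
    show "gegenbauer_deriv l (Suc n) x * gegenbauer l n x =
        x * gegenbauer_deriv l n x * gegenbauer l n x + (real n + 2 * l) * (gegenbauer l n x)\<^sup>2"
      unfolding d by (simp add: algebra_simps power2_eq_square)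
  qed
  also have "\<dots> = integral {0..1} (\<lambda>x. x * gegenbauer_deriv l n x * gegenbauer l n x)
      + (real n + 2 * l) * l2_norm_sq (gegenbauer l n)"
    unfolding l2_norm_sq_def
    by (subst integral_add) (auto intro!: integrable_continuous_real continuous_intros)
  finally show ?thesis
    using gegenbauer_integral_x_deriv[of l n] by (simp add: algebra_simps)
qed

section \<open>Recurrences for squared norms and the closed form\<close>

text \<open>The two mixed integrals add up to the boundary term at 1, whose double completes the
  square.\<close>

lemma l2_norm_sq_gegenbauer_Suc:
  "(2 * real n + 3) * l2_norm_sq (gegenbauer l (Suc n)) =
   (gegenbauer l (Suc n) 1 - gegenbauer l n 1)\<^sup>2
     + (2 * real n + 4 * l - 1) * l2_norm_sq (gegenbauer l n)"
  using gegenbauer_integral_by_parts[of l n] gegenbauer_integral_mult_deriv[of l n]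
    gegenbauer_integral_deriv_mult[of l n]
  by (simp add: power2_diff)

lemma l2_norm_sq_gegenbauer_deriv_Suc:
  "l2_norm_sq (gegenbauer_deriv l (Suc n)) - l2_norm_sq (gegenbauer_deriv l n) =
     (real n + 2 * l) * integral {0..1} (\<lambda>x. gegenbauer_deriv l (Suc n) x * gegenbauer l n x)
     + real (Suc n) * integral {0..1} (\<lambda>x. gegenbauer l (Suc n) x * gegenbauer_deriv l n x)"
proof -
  have "l2_norm_sq (gegenbauer_deriv l (Suc n)) - l2_norm_sq (gegenbauer_deriv l n) =
      integral {0..1} (\<lambda>x. (gegenbauer_deriv l (Suc n) x)\<^sup>2 - (gegenbauer_deriv l n x)\<^sup>2)"
    unfolding l2_norm_sq_def
    by (subst integral_diff) (auto intro!: integrable_continuous_real continuous_intros)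
  also have "\<dots> = integral {0..1} (\<lambda>x.
      (real n + 2 * l) * (gegenbauer_deriv l (Suc n) x * gegenbauer l n x)
        + real (Suc n) * (gegenbauer l (Suc n) x * gegenbauer_deriv l n x))"
  proof (rule integral_cong)
    fix x
    let ?u = "gegenbauer_deriv l (Suc n) x" and ?v = "gegenbauer_deriv l n x"
    \<comment> \<open>The cross terms x u v cancel, and the two brackets are the left sides of the
      derivative identities.\<close>
    have "?u\<^sup>2 - ?v\<^sup>2 = ?u * (?u - x * ?v) + ?v * (x * ?u - ?v)"
      by (simp add: algebra_simps power2_eq_square)
    then show "?u\<^sup>2 - ?v\<^sup>2 = (real n + 2 * l) * (?u * gegenbauer l n x)
        + real (Suc n) * (gegenbauer l (Suc n) x * ?v)"
      unfolding gegenbauer_deriv_upper gegenbauer_deriv_lower by (simp only: ac_simps)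
  qed
  also have "\<dots> =
      (real n + 2 * l) * integral {0..1} (\<lambda>x. gegenbauer_deriv l (Suc n) x * gegenbauer l n x)
      + real (Suc n) * integral {0..1} (\<lambda>x. gegenbauer l (Suc n) x * gegenbauer_deriv l n x)"
    by (subst integral_add) (auto intro!: integrable_continuous_real continuous_intros)
  finally show ?thesis .
qed

text \<open>The target formula at degree n+1, multiplied by 4 l^2. The induction can start at n = 0,
  where the left side is 0.\<close>

lemma l2_norm_sq_gegenbauer_deriv:
  assumes "l \<noteq> 0"
  shows "l2_norm_sq (gegenbauer_deriv l n) =
    real (Suc n) * (real (Suc n) - 2 * l) / (4 * l) * (gegenbauer l (Suc n) 1)\<^sup>2
    + real (Suc n) * (2 * real n + 3) / 2 * l2_norm_sq (gegenbauer l (Suc n))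
    - (\<Sum>k=0..n. (l + real k) * l2_norm_sq (gegenbauer l k))"
proof (induction n)
  case 0
  have "l2_norm_sq (gegenbauer_deriv l 0) = 0" "l2_norm_sq (\<lambda>_. 1) = 1"
    by (simp_all add: l2_norm_sq_def gegenbauer_deriv_def)
  moreover have "gegenbauer l (Suc 0) 1 = 2 * l"
    using gegenbauer_at_1_Suc[of 0 l] by simp
  ultimately show ?case
    using l2_norm_sq_gegenbauer_Suc[of 0 l] assms
    by (simp add: power2_eq_square field_simps)
next
  case (Suc n)
  define N where "N = real (Suc n)"
  define u where "u = gegenbauer l (Suc n) 1"
  define w where "w = gegenbauer l (Suc (Suc n)) 1"
  define U where "U = l2_norm_sq (gegenbauer l (Suc n))"
  define W where "W = l2_norm_sq (gegenbauer l (Suc (Suc n)))"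
  define A where "A = integral {0..1} (\<lambda>x. gegenbauer_deriv l (Suc n) x * gegenbauer l n x)"
  define B where "B = integral {0..1} (\<lambda>x. gegenbauer l (Suc n) x * gegenbauer_deriv l n x)"
  define D where "D = l2_norm_sq (gegenbauer_deriv l n)"
  define S where "S = (\<Sum>k=0..n. (l + real k) * l2_norm_sq (gegenbauer l k))"
  have N: "real n = N - 1" "real (Suc n) = N" "real (Suc (Suc n)) = N + 1" "N + 1 \<noteq> 0"
    by (simp_all add: N_def)
  have w: "(N + 1) * w = (N + 2 * l) * u"
    using gegenbauer_at_1_Suc[of "Suc n" l] by (simp add: N_def u_def w_def algebra_simps)
  have v: "(N - 1 + 2 * l) * gegenbauer l n 1 = N * u"
    using gegenbauer_at_1_Suc[of n l] by (simp add: N_def u_def)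
  have W: "(2 * N + 3) * W = (w - u)\<^sup>2 + (2 * N + 4 * l - 1) * U"
    using l2_norm_sq_gegenbauer_Suc[of "Suc n" l] by (simp add: N_def u_def w_def U_def W_def)
  have AB: "A + B = u * gegenbauer l n 1"
    unfolding A_def B_def u_def by (rule gegenbauer_integral_by_parts)
  have B: "2 * B = u\<^sup>2 - (2 * N + 1) * U"
    using gegenbauer_integral_mult_deriv[of l n]
    by (simp add: B_def u_def U_def N_def algebra_simps)
  have "l2_norm_sq (gegenbauer_deriv l (Suc n)) = D + (N - 1 + 2 * l) * A + N * B"
    using l2_norm_sq_gegenbauer_deriv_Suc[of l n] by (simp add: A_def B_def D_def N_def)
  \<comment> \<open>Grouping \<open>A + B\<close> brings in the boundary term, and \<open>v\<close>
    then eliminates C_n(1) in favour of \<open>u\<close>.\<close>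
  also have "\<dots> = D + (N - 1 + 2 * l) * (A + B) + (1 - 2 * l) * B"
    by (simp add: algebra_simps)
  also have "(N - 1 + 2 * l) * (A + B) = N * u\<^sup>2"
    using v unfolding AB by (simp add: power2_eq_square mult.left_commute)
  also have "B = (u\<^sup>2 - (2 * N + 1) * U) / 2"
    using B by simp
  also have "D = N * (N - 2 * l) / (4 * l) * u\<^sup>2 + N * (2 * N + 1) / 2 * U - S"
    using Suc.IH by (simp add: D_def S_def u_def U_def N_def)
  \<comment> \<open>On the right, \<open>W\<close> is already expanded by its recurrence. Once
    \<open>w\<close> is written as a multiple of \<open>u\<close>, a rational identity in N, l, u,
    U, S remains.\<close>
  also have "N * (N - 2 * l) / (4 * l) * u\<^sup>2 + N * (2 * N + 1) / 2 * U - S + N * u\<^sup>2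
      + (1 - 2 * l) * ((u\<^sup>2 - (2 * N + 1) * U) / 2) =
      (N + 1) * (N + 1 - 2 * l) / (4 * l) * w\<^sup>2
      + (N + 1) / 2 * ((w - u)\<^sup>2 + (2 * N + 4 * l - 1) * U) - (S + (l + N) * U)"
  proof -
    have "w = (N + 2 * l) * u / (N + 1)"
      using w N(4) by (simp add: field_simps)
    then show ?thesis
      using N(4) assms by (simp add: divide_simps) algebra
  qed
  also have "\<dots> = (N + 1) * (N + 1 - 2 * l) / (4 * l) * w\<^sup>2
      + (N + 1) * (2 * N + 3) / 2 * W - (S + (l + N) * U)"
    unfolding W[symmetric] by simp
  finally show ?case
    by (simp only: N u_def w_def U_def W_def S_def sum.atLeast0_atMost_Suc)
qed

theorem theorem1p3:
  fixes l :: real and n :: nat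
  assumes "l \<in> {-1/2<..<0} \<union> {0<..}" and "n > 1"
  shows "l2_norm_sq (gegenbauer (l + 1) (n - 2)) =
           (real n ^ 2 - 2 * l * real n) / (2 ^ 4 * l ^ 3) * (gegenbauer l n 1)\<^sup>2
           + real n * (2 * real n + 1) / (2 ^ 3 * l\<^sup>2) * l2_norm_sq (gegenbauer l n)
           - (\<Sum>k = 0..n - 1. (l + real k) / (2\<^sup>2 * l\<^sup>2) * l2_norm_sq (gegenbauer l k))"
proof -
  have l: "l \<noteq> 0" using assms(1) by auto
  obtain m where n: "n = Suc (Suc m)"
    using assms(2) by (metis One_nat_def less_imp_Suc_add add_Suc_right plus_1_eq_Suc)
  define S where "S = (\<Sum>k=0..Suc m. (l + real k) * l2_norm_sq (gegenbauer l k))"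
  \<comment> \<open>The factor is (2 l)^2, from C_{m+1}' = 2 l C_m^(l+1); here m = n - 2.\<close>
  have "l2_norm_sq (gegenbauer_deriv l (Suc m)) = 4 * l\<^sup>2 * l2_norm_sq (gegenbauer (l + 1) m)"
    by (simp add: l2_norm_sq_def gegenbauer_deriv_def power_mult_distrib)
  then have "l2_norm_sq (gegenbauer (l + 1) m) =
      l2_norm_sq (gegenbauer_deriv l (Suc m)) / (4 * l\<^sup>2)"
    using l by simp
  also have "l2_norm_sq (gegenbauer_deriv l (Suc m)) =
      real n * (real n - 2 * l) / (4 * l) * (gegenbauer l n 1)\<^sup>2
      + real n * (2 * real n + 1) / 2 * l2_norm_sq (gegenbauer l n) - S"
    using l2_norm_sq_gegenbauer_deriv[OF l, of "Suc m"] by (simp add: S_def n algebra_simps)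
  also have "\<dots> / (4 * l\<^sup>2) =
      (real n ^ 2 - 2 * l * real n) / (2 ^ 4 * l ^ 3) * (gegenbauer l n 1)\<^sup>2
      + real n * (2 * real n + 1) / (2 ^ 3 * l\<^sup>2) * l2_norm_sq (gegenbauer l n) - S / (2\<^sup>2 * l\<^sup>2)"
    using l by (simp add: divide_simps) algebra
  also have "S / (2\<^sup>2 * l\<^sup>2) =
      (\<Sum>k = 0..n - 1. (l + real k) / (2\<^sup>2 * l\<^sup>2) * l2_norm_sq (gegenbauer l k))"
    by (simp add: S_def n sum_divide_distrib del: sum.atLeast0_atMost_Suc sum.cl_ivl_Suc)
  finally show ?thesis by (simp add: n)
qed

end
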